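(* Let $\Gamma=\mathrm{OSC}(G,R,L,S)$ be an oriented semi-Cayley graph over an abelian group $G$ of order $n$. Let $g,h\in G$ and suppose that $u=(g,0)$ and $v=(h,1)$ are strongly cospectral in $\Gamma$. Let $\alpha,\beta$ be nonzero real numbers and $t\in\mathbb{R}$. Then $\Gamma$ admits $(\alpha,\beta)$-FR from $u=(g,0)$ to $v=(h,1)$ at time $t$ if and only if all the following conditions hold: (a) $G$ can be written as $K_1\cup K_2$, where $$K_1=\left\{k_1\in G:\overline{\chi_{k_1}(S)}\chi_{k_1}(g^{-1}h)=+|\chi_{k_1}(S)|\right\},\qquad K_2=\left\{k_2\in G:\overline{\chi_{k_2}(S)}\chi_{k_2}(g^{-1}h)=-|\chi_{k_2}(S)|\right\};$$ (b) for every $k_1\in K_1$ and every $k_2\in K_2$, respectively, $$(\lambda_{k_1}^{+}-\lambda_0^{+})t\in2\pi\mathrm{i}\mathbb{Z},\qquad(\lambda_{k_2}^{-}-\lambda_0^{+})t\in2\pi\mathrm{i}\mathbb{Z};$$ moreover, $$\alpha=\mathrm{Re}\left(\exp(t\lambda_0^{+})\right),\qquad \beta=-\mathrm{Im}\left(\exp(t\lambda_0^{+})\right).$$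
   Context: An oriented graph $\Gamma$ is a finite graph with edge set $E(\Gamma)\subseteq V(\Gamma)\times V(\Gamma)$ such that $(u,v)\in E(\Gamma)$ implies $(v,u)\notin E(\Gamma)$. Its adjacency matrix $A_\Gamma=[a_{uv}]$ has $a_{uv}=1$ if $(u,v)\in E(\Gamma)$, $a_{uv}=-1$ if $(v,u)\in E(\Gamma)$, and $0$ otherwise. The transition matrix is $U(t)=\exp(A_\Gamma t)$, $t\in\mathbb{R}$. $\mathbf{e}_u$ is the standard basis vector indexed by $u$. Fractional revival: for distinct vertices $u,v$ and real $\alpha,\beta$ with $\alpha^2+\beta^2=1$, $\beta\neq0$, $\Gamma$ admits $(\alpha,\beta)$-FR from $u$ to $v$ at time $t$ if $U(t)\mathbf{e}_u=\alpha\mathbf{e}_u+\beta\mathbf{e}_v$. Strong cospectrality: let $N=|V(\Gamma)|$, let $\lambda_1,\dots,\lambda_N$ be the eigenvalues of $A_\Gamma$ (with multiplicity) with corresponding orthonormal eigenvectors $\mathbf{x}_1,\dots,\mathbf{x}_N$, and put $E_{\lambda_r}=\mathbf{x}_r\mathbf{x}_r^H$. Vertices $u,v$ are strongly cospectral if for every $r$ there is a phase factor $e^{\mathrm{i}\pi q_r(u,v)}$ ($q_r(u,v)\in\mathbb{R}$) such that $E_{\lambda_r}\mathbf{e}_u=e^{\mathrm{i}\pi q_r(u,v)}E_{\lambda_r}\mathbf{e}_v$, with the condition that $\lambda_i=\lambda_j$ implies $e^{\mathrm{i}\pi q_i(u,v)}=e^{\mathrm{i}\pi q_j(u,v)}$.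 Oriented semi-Cayley graph: let $G$ be a finite group with identity $e$ and let $R,L,S\subseteq G$ satisfy $R\cap R^{-1}=L\cap L^{-1}=\emptyset$ and $e\notin R\cup L$. $\mathrm{OSC}(G,R,L,S)$ is the oriented graph with vertex set $\{(g,0),(g,1)\mid g\in G\}$ and directed edges $((g,0),(h,0))$ with $g^{-1}h\in R$; $((g,1),(h,1))$ with $g^{-1}h\in L$; and $((g,0),(h,1))$ with $g^{-1}h\in S$. Characters: write the finite abelian group as $G=\mathbb{Z}_{n_1}\oplus\cdots\oplus\mathbb{Z}_{n_p}$. For $z=(z_1,\dots,z_p)\in G$, $\chi_z(g)=\prod_{s=1}^p\omega_{n_s}^{z_sg_s}$ for $g=(g_1,\dots,g_p)\in G$, where $\omega_{n_s}=\exp(2\pi\mathrm{i}/n_s)$. For $T\subseteq G$, $\chi_z(T)=\sum_{x\in T}\chi_z(x)$. The group operation is also written multiplicatively; the index $0$ denotes the identity of $G$, so $\chi_0$ is the trivial character. For $k\in G$ put $r_k=\chi_k(R)-\chi_k(R^{-1})$, $l_k=\chi_k(L)-\chi_k(L^{-1})$ and $$\lambda_k^{\pm}=\frac12\left(r_k+l_k\pm\mathrm{i}\left|\sqrt{(l_k-r_k)^2-4|\chi_k(S)|^2}\right|\right)$$ (here $(l_k-r_k)^2-4|\chi_k(S)|^2\le0$), with the convention $\lambda_k^+=r_k$, $\lambda_k^-=l_k$ if $\chi_k(S)=0$. *)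

theory Defs
  imports "HOL-Analysis.Analysis" "HOL-Algebra.Elementary_Groups" "HOL-Algebra.Product_Groups"
begin

text \<open>
  The vertex set of a graph is the whole of a finite type, so an oriented graph is given by its
  edge set, and adjacency and transition matrices are complex matrices indexed by the vertex type.
\<close>

definition oriented_graph :: "('v::finite \<times> 'v) set \<Rightarrow> bool" where
  "oriented_graph E \<longleftrightarrow> (\<forall>u v. (u, v) \<in> E \<longrightarrow> (v, u) \<notin> E)"

definition adjacency :: "('v::finite \<times> 'v) set \<Rightarrow> complex^'v^'v" where
  "adjacency E = (\<chi> u v. if (u, v) \<in> E then 1 else if (v, u) \<in> E then - 1 else 0)"

primrec mat_power :: "complex^'v::finite^'v \<Rightarrow> nat \<Rightarrow> complex^'v^'v" where
  "mat_power A 0 = mat 1"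
| "mat_power A (Suc k) = A ** mat_power A k"

text \<open>
  The library has no exponential for the type of square matrices (\<open>exp\<close> needs a Banach algebra,
  and \<open>*\<close> on vectors is componentwise), hence the power series.
\<close>

definition mat_exp :: "complex^'v::finite^'v \<Rightarrow> complex^'v^'v" where
  "mat_exp A = (\<Sum>k. mat_power A k /\<^sub>R fact k)"

definition transition :: "('v::finite \<times> 'v) set \<Rightarrow> real \<Rightarrow> complex^'v^'v" where
  "transition E t = mat_exp (t *\<^sub>R adjacency E)"

definition fractional_revival ::
    "('v::finite \<times> 'v) set \<Rightarrow> real \<Rightarrow> real \<Rightarrow> 'v \<Rightarrow> 'v \<Rightarrow> real \<Rightarrow> bool" where
  "fractional_revival E \<alpha> \<beta> u v t \<longleftrightarrow>
     u \<noteq> v \<and> \<alpha>\<^sup>2 + \<beta>\<^sup>2 = 1 \<and> \<beta> \<noteq> 0 \<and>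
     transition E t *v axis u 1 = of_real \<alpha> *s axis u 1 + of_real \<beta> *s axis v 1"

text \<open>
  An orthonormal eigenbasis of \<open>A\<close>: the vectors \<open>x r\<close> for \<open>r < N\<close>, with \<open>N\<close> the number of vertices.
  The inner product is spelled out because the library's \<open>\<bullet>\<close> on complex vectors is only its real part.
  As there are \<open>N\<close> vectors, the \<open>ev r\<close> run through the spectrum with multiplicity.
\<close>

definition orthonormal_eigenbasis ::
    "complex^'v::finite^'v \<Rightarrow> (nat \<Rightarrow> complex) \<Rightarrow> (nat \<Rightarrow> complex^'v) \<Rightarrow> bool" where
  "orthonormal_eigenbasis A ev x \<longleftrightarrow>
     (\<forall>r<CARD('v). A *v x r = ev r *s x r) \<and>
     (\<forall>r<CARD('v). \<forall>s<CARD('v).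
        (\<Sum>w\<in>UNIV. cnj (x r $ w) * x s $ w) = (if r = s then 1 else 0))"

definition rank_one_proj :: "complex^'v::finite \<Rightarrow> complex^'v^'v" where
  "rank_one_proj x = (\<chi> u v. x $ u * cnj (x $ v))"

text \<open>
  Since equal eigenvalues must get equal phases, the condition below says that
  \<open>P *v axis u 1\<close> and \<open>P *v axis v 1\<close> differ by a phase for every eigenprojection \<open>P\<close>.  So it does
  not depend on which eigenbasis is taken, and it makes no difference that we quantify existentially.
\<close>

definition strongly_cospectral :: "('v::finite \<times> 'v) set \<Rightarrow> 'v \<Rightarrow> 'v \<Rightarrow> bool" where
  "strongly_cospectral E u v \<longleftrightarrow>
     (\<exists>ev x. orthonormal_eigenbasis (adjacency E) ev x \<and>
        (\<exists>q::nat \<Rightarrow> real.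
           (\<forall>r<CARD('v). rank_one_proj (x r) *v axis u 1 =
              exp (\<i> * of_real (pi * q r)) *s (rank_one_proj (x r) *v axis v 1)) \<and>
           (\<forall>i<CARD('v). \<forall>j<CARD('v). ev i = ev j \<longrightarrow>
              exp (\<i> * of_real (pi * q i)) = exp (\<i> * of_real (pi * q j)))))"

text \<open>
  Groups are written additively: \<open>- g + h\<close> is \<open>g\<^sup>-\<^sup>1 h\<close>, \<open>uminus ` R\<close> is the set of inverses of \<open>R\<close>,
  and \<open>0\<close> is the identity.  The second component of a vertex lives in the two-element numeral
  type \<open>2\<close>, whose elements are \<open>0\<close> and \<open>1\<close>.
\<close>

definition OSC :: "'g::{finite,group_add} set \<Rightarrow> 'g set \<Rightarrow> 'g set \<Rightarrow> (('g \<times> 2) \<times> ('g \<times> 2)) set" where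
  "OSC R L S =
     {((g, 0), (h, 0)) |g h. - g + h \<in> R} \<union>
     {((g, 1), (h, 1)) |g h. - g + h \<in> L} \<union>
     {((g, 0), (h, 1)) |g h. - g + h \<in> S}"

lemma oriented_graph_OSC:
  assumes "R \<inter> uminus ` R = {}" "L \<inter> uminus ` L = {}"
  shows "oriented_graph (OSC R L S)"
proof -
  have *: "- h + g \<notin> T" if T: "T \<inter> uminus ` T = {}" "- g + h \<in> T" for T and g h :: 'a
  proof
    assume "- h + g \<in> T"
    then have "- (- h + g) \<in> uminus ` T"
      by (rule imageI)
    also have "- (- h + g) = - g + h"
      by (simp only: minus_add minus_minus)
    finally show False
      using T by blast
  qed
  show ?thesis
    unfolding oriented_graph_def OSC_def
    by (simp only: Un_iff mem_Collect_eq prod.inject) (auto dest: *[OF assms(1)] *[OF assms(2)])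
qed

definition additive_group :: "'g::ab_group_add monoid" where
  "additive_group = \<lparr>carrier = UNIV, monoid.mult = (+), one = 0\<rparr>"

text \<open>
  \<open>cyclic_decomposition p m \<phi>\<close>: the map \<open>\<phi>\<close> identifies the group with the direct sum of the cyclic
  groups of orders \<open>m 0, \<dots>, m (p - 1)\<close>; \<open>\<phi> g s\<close> is the \<open>s\<close>-th coordinate of \<open>g\<close>, an integer in
  \<open>{0..<m s}\<close>.  Positivity is required since \<open>integer_mod_group 0\<close> is infinite cyclic.
\<close>

definition cyclic_decomposition ::
    "nat \<Rightarrow> (nat \<Rightarrow> nat) \<Rightarrow> ('g::{finite,ab_group_add} \<Rightarrow> nat \<Rightarrow> int) \<Rightarrow> bool" where
  "cyclic_decomposition p m \<phi> \<longleftrightarrow>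
     (\<forall>s<p. 0 < m s) \<and>
     \<phi> \<in> iso additive_group (product_group {..<p} (\<lambda>s. integer_mod_group (m s)))"

definition group_char ::
    "nat \<Rightarrow> (nat \<Rightarrow> nat) \<Rightarrow> ('g \<Rightarrow> nat \<Rightarrow> int) \<Rightarrow> 'g \<Rightarrow> 'g \<Rightarrow> complex" where
  "group_char p m \<phi> z g = (\<Prod>s<p. exp (2 * of_real pi * \<i> / of_nat (m s)) powi (\<phi> z s * \<phi> g s))"

definition char_sum :: "('g \<Rightarrow> 'g \<Rightarrow> complex) \<Rightarrow> 'g \<Rightarrow> 'g set \<Rightarrow> complex" where
  "char_sum X z T = (\<Sum>x\<in>T. X z x)"

definition char_diff :: "('g::{finite,ab_group_add} \<Rightarrow> 'g \<Rightarrow> complex) \<Rightarrow> 'g set \<Rightarrow> 'g \<Rightarrow> complex" where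
  "char_diff X T k = char_sum X k T - char_sum X k (uminus ` T)"

definition eig_plus ::
    "('g::{finite,ab_group_add} \<Rightarrow> 'g \<Rightarrow> complex) \<Rightarrow> 'g set \<Rightarrow> 'g set \<Rightarrow> 'g set \<Rightarrow> 'g \<Rightarrow> complex" where
  "eig_plus X R L S k =
     (let r = char_diff X R k; l = char_diff X L k; s = char_sum X k S in
      if s = 0 then r
      else (r + l + \<i> * of_real (cmod (csqrt ((l - r)\<^sup>2 - 4 * (of_real (cmod s))\<^sup>2)))) / 2)"

definition eig_minus ::
    "('g::{finite,ab_group_add} \<Rightarrow> 'g \<Rightarrow> complex) \<Rightarrow> 'g set \<Rightarrow> 'g set \<Rightarrow> 'g set \<Rightarrow> 'g \<Rightarrow> complex" where
  "eig_minus X R L S k =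
     (let r = char_diff X R k; l = char_diff X L k; s = char_sum X k S in
      if s = 0 then l
      else (r + l - \<i> * of_real (cmod (csqrt ((l - r)\<^sup>2 - 4 * (of_real (cmod s))\<^sup>2)))) / 2)"

end

theory Submission
  imports Defs
begin

text \<open>
  The spaces spanned by \<open>(a \<chi>\<^sub>k, b \<chi>\<^sub>k)\<close> are invariant under the adjacency matrix, which acts on
  them by the block with rows \<open>(r\<^sub>k, s)\<close> and \<open>(- cnj s, l\<^sub>k)\<close>, where \<open>s = \<chi>\<^sub>k(S)\<close>.  Strong
  cospectrality makes every eigenvector have entries of equal modulus at \<open>u\<close> and \<open>v\<close>, so
  \<open>s \<noteq> 0\<close> and \<open>r\<^sub>k = l\<^sub>k\<close>.  Testing the revival equation against the eigenvectors (which are left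
  eigenvectors too, as the adjacency matrix is skew-symmetric) turns it into
  \<open>exp (- t (r\<^sub>k + \<i> \<epsilon> \<bar>s\<bar>)) = \<alpha> + \<i> \<epsilon> \<beta> z\<^sub>k\<close> for all \<open>k\<close> and \<open>\<epsilon> = 1, -1\<close>, where \<open>z\<^sub>k\<close> is the
  phase of \<open>cnj s * \<chi>\<^sub>k(g\<inverse>h)\<close>.  As \<open>\<alpha>\<close>, \<open>\<beta>\<close> are real and nonzero, \<open>exp (t r\<^sub>k)\<close> is real and
  \<open>z\<^sub>k\<close> is \<open>1\<close> or \<open>-1\<close>; the sign decides between \<open>K1\<close> and \<open>K2\<close>.
\<close>

subsection \<open>Matrix exponential and eigenvectors\<close>

lemma matrix_vector_mult_axis:
  fixes M :: "complex^'v::finite^'w::finite"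
  shows "(M *v axis u 1) $ w = M $ w $ u"
  by (simp add: matrix_vector_mult_def axis_def if_distrib cong: if_cong)

text \<open>The sum of the moduli of all entries dominates every row sum, so each further factor
  \<open>B\<close> costs at most this constant. It gives the scalar series that dominates the
  exponential entrywise.\<close>

lemma mat_power_entry_bound:
  fixes B :: "complex^'v::finite^'v"
  shows "cmod (mat_power B k $ i $ j) \<le> (\<Sum>i\<in>UNIV. \<Sum>l\<in>UNIV. cmod (B $ i $ l)) ^ k"
proof (induction k arbitrary: i)
  case 0
  then show ?case by (simp add: mat_def)
next
  case (Suc k)
  define C where "C = (\<Sum>i\<in>UNIV. \<Sum>l\<in>UNIV. cmod (B $ i $ l))"
  have C0: "C \<ge> 0"
    unfolding C_def by (intro sum_nonneg) auto
  have row: "(\<Sum>l\<in>UNIV. cmod (B $ i $ l)) \<le> C"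
    unfolding C_def by (rule member_le_sum) (auto intro: sum_nonneg)
  have "cmod (mat_power B (Suc k) $ i $ j) \<le> (\<Sum>l\<in>UNIV. cmod (B $ i $ l * mat_power B k $ l $ j))"
    by (simp add: matrix_matrix_mult_def norm_sum)
  also have "\<dots> \<le> (\<Sum>l\<in>UNIV. cmod (B $ i $ l) * C ^ k)"
    unfolding norm_mult by (intro sum_mono mult_left_mono) (use Suc in \<open>auto simp: C_def\<close>)
  also have "\<dots> \<le> C * C ^ k"
    unfolding sum_distrib_right[symmetric] by (intro mult_right_mono row) (use C0 in auto)
  finally show ?case
    by (simp add: C_def)
qed

lemma mat_exp_entry_sums:
  fixes B :: "complex^'v::finite^'v"
  shows "(\<lambda>k. mat_power B k $ i $ j /\<^sub>R fact k) sums (mat_exp B $ i $ j)"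
proof -
  have summ: "summable (\<lambda>k. mat_power B k $ i $ j /\<^sub>R fact k)" for i j
  proof (rule summable_comparison_test')
    show "summable (\<lambda>k. (\<Sum>i\<in>UNIV. \<Sum>l\<in>UNIV. cmod (B $ i $ l)) ^ k /\<^sub>R fact k)"
      by (rule summable_exp_generic)
    show "norm (mat_power B k $ i $ j /\<^sub>R fact k)
        \<le> (\<Sum>i\<in>UNIV. \<Sum>l\<in>UNIV. cmod (B $ i $ l)) ^ k /\<^sub>R fact k" for k
      using mat_power_entry_bound[of B k i j] by (simp add: mult_left_mono)
  qed
  define M where "M = (\<chi> i j. \<Sum>k. mat_power B k $ i $ j /\<^sub>R fact k)"
  have M: "(\<lambda>k. mat_power B k $ i $ j /\<^sub>R fact k) sums (M $ i $ j)" for i j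
    using summ[THEN summable_sums] by (simp add: M_def)
  have "(\<lambda>k. mat_power B k /\<^sub>R fact k) sums M"
    unfolding sums_def
    by (intro vec_tendstoI) (use M in \<open>simp add: sums_def\<close>)
  then have "mat_exp B = M"
    unfolding mat_exp_def by (rule sums_unique[symmetric])
  then show ?thesis
    using M by simp
qed

text \<open>Left eigenvectors are the useful ones: the pairing of \<open>y\<close> with column
  \<open>u\<close> of the exponential is the entry of \<open>y v* mat_exp B\<close> at
  \<open>u\<close>.\<close>

lemma mat_exp_left_eigenvector:
  fixes B :: "complex^'v::finite^'v"
  assumes "y v* B = \<theta> *s y"
  shows "y v* mat_exp B = exp \<theta> *s y"
proof -
  have pow: "y v* mat_power B k = \<theta> ^ k *s y" for k
  proof (induction k)
    case (Suc k)
    have "y v* mat_power B (Suc k) = (y v* B) v* mat_power B k"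
      by (simp add: vector_matrix_mul_assoc)
    also have "\<dots> = \<theta> *s (y v* mat_power B k)"
      by (simp add: assms scalar_vector_matrix_assoc)
    finally show ?case
      by (simp add: Suc)
  qed simp
  have "(y v* mat_exp B) $ j = exp \<theta> * y $ j" for j
  proof -
    have "(\<lambda>k. \<Sum>i\<in>UNIV. (mat_power B k $ i $ j /\<^sub>R fact k) * y $ i)
        sums (\<Sum>i\<in>UNIV. mat_exp B $ i $ j * y $ i)"
      by (intro sums_sum sums_mult2 mat_exp_entry_sums)
    moreover have "(\<Sum>i\<in>UNIV. (mat_power B k $ i $ j /\<^sub>R fact k) * y $ i) = (\<theta> ^ k /\<^sub>R fact k) * y $ j" for k
    proof -
      have "(\<Sum>i\<in>UNIV. (mat_power B k $ i $ j /\<^sub>R fact k) * y $ i) = (y v* mat_power B k) $ j /\<^sub>R fact k"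
        by (simp add: vector_matrix_mult_def scaleR_sum_right mult.commute)
      then show ?thesis
        by (simp add: pow)
    qed
    moreover have "(\<lambda>k. (\<theta> ^ k /\<^sub>R fact k) * y $ j) sums (exp \<theta> * y $ j)"
      by (intro sums_mult2 exp_converges)
    ultimately show ?thesis
      by (auto simp: vector_matrix_mult_def mult.commute dest: sums_unique2)
  qed
  then show ?thesis
    by (simp add: vec_eq_iff)
qed

text \<open>Orthonormality says \<open>Q' ** Q = mat 1\<close>; for square matrices this forces
  \<open>Q ** Q' = mat 1\<close>, which is completeness. The bijection \<open>idx\<close> is there
  because the basis is numbered by naturals and matrices by vertices.\<close>

lemma orthonormal_eigenbasis_expansion:
  fixes A :: "complex^'v::finite^'v"
  assumes "orthonormal_eigenbasis A ev x"
  shows "y = (\<Sum>r<CARD('v). (\<Sum>w\<in>UNIV. cnj (x r $ w) * y $ w) *s x r)"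
proof -
  obtain idx :: "'v \<Rightarrow> nat" where "bij_betw idx UNIV {0..<CARD('v)}"
    using ex_bij_betw_finite_nat[of "UNIV::'v set"] by auto
  then have idx: "bij_betw idx UNIV {..<CARD('v)}"
    by (simp add: lessThan_atLeast0)
  define Q :: "complex^'v^'v" where "Q = (\<chi> w i. x (idx i) $ w)"
  define Q' :: "complex^'v^'v" where "Q' = (\<chi> i w. cnj (x (idx i) $ w))"
  have "idx i < CARD('v)" for i
    using idx by (auto simp: bij_betw_def)
  moreover have "idx i = idx j \<longleftrightarrow> i = j" for i j
    using idx by (auto simp: bij_betw_def inj_on_def)
  ultimately have "Q' ** Q = mat 1"
    using assms
    by (simp add: orthonormal_eigenbasis_def Q_def Q'_def matrix_matrix_mult_def mat_def vec_eq_iff)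
  then have "Q ** Q' = mat 1"
    by (simp add: matrix_left_right_inverse)
  then have y: "Q *v (Q' *v y) = y"
    by (simp add: matrix_vector_mul_assoc)
  have "y $ v = (\<Sum>r<CARD('v). (\<Sum>w\<in>UNIV. cnj (x r $ w) * y $ w) * x r $ v)" for v
  proof -
    have "y $ v = (Q *v (Q' *v y)) $ v"
      unfolding y ..
    also have "\<dots> = (\<Sum>i\<in>UNIV. (\<Sum>w\<in>UNIV. cnj (x (idx i) $ w) * y $ w) * x (idx i) $ v)"
      by (simp add: Q_def Q'_def matrix_vector_mult_def mult.commute)
    also have "\<dots> = (\<Sum>r<CARD('v). (\<Sum>w\<in>UNIV. cnj (x r $ w) * y $ w) * x r $ v)"
      by (rule sum.reindex_bij_betw[OF idx])
    finally show ?thesis .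
  qed
  then show ?thesis
    unfolding vec_eq_iff sum_component vector_smult_component by blast
qed

text \<open>An eigenvector for \<theta> involves only basis vectors with eigenvalue \<theta>, and
  these share one phase. So its entries at \<open>u\<close> and \<open>v\<close> differ by that
  phase too. This frees strong cospectrality from the basis chosen in its definition.\<close>

lemma strongly_cospectral_eigenvector:
  fixes E :: "('v::finite \<times> 'v) set"
  assumes sc: "strongly_cospectral E u v" and y: "adjacency E *v y = \<theta> *s y"
  shows "cmod (y $ u) = cmod (y $ v)"
proof -
  obtain ev x and q :: "nat \<Rightarrow> real" where basis: "orthonormal_eigenbasis (adjacency E) ev x"
    and phase: "\<And>r. r < CARD('v) \<Longrightarrow> rank_one_proj (x r) *v axis u 1 =
              exp (\<i> * of_real (pi * q r)) *s (rank_one_proj (x r) *v axis v 1)"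
    and same: "\<And>i j. i < CARD('v) \<Longrightarrow> j < CARD('v) \<Longrightarrow> ev i = ev j \<Longrightarrow>
              exp (\<i> * of_real (pi * q i)) = exp (\<i> * of_real (pi * q j))"
    using sc unfolding strongly_cospectral_def by metis
  define ph where "ph r = exp (\<i> * of_real (pi * q r))" for r
  define c where "c r = (\<Sum>w\<in>UNIV. cnj (x r $ w) * y $ w)" for r
  have ev: "adjacency E *v x r = ev r *s x r" if "r < CARD('v)" for r
    using basis that by (simp add: orthonormal_eigenbasis_def)
  have ortho: "(\<Sum>w\<in>UNIV. cnj (x r $ w) * x s $ w) = (if r = s then 1 else 0)"
    if "r < CARD('v)" "s < CARD('v)" for r s
    using basis that by (simp add: orthonormal_eigenbasis_def)
  have expand: "y = (\<Sum>r<CARD('v). c r *s x r)"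
    unfolding c_def by (rule orthonormal_eigenbasis_expansion[OF basis])
  \<comment> \<open>The column of \<open>rank_one_proj (x r)\<close> at \<open>u\<close> is
    \<open>cnj (x r $ u)\<close> times \<open>x r\<close>; comparing columns at a nonzero coordinate
    of \<open>x r\<close> cancels the vector.\<close>
  have coord: "x r $ u = cnj (ph r) * x r $ v" if r: "r < CARD('v)" for r
  proof -
    have "x r \<noteq> 0"
      using ortho[OF r r] by auto
    then obtain w where w: "x r $ w \<noteq> 0"
      by (auto simp: vec_eq_iff)
    have "(rank_one_proj (x r) *v axis u 1) $ w = (ph r *s (rank_one_proj (x r) *v axis v 1)) $ w"
      using phase[OF r] by (simp add: ph_def)
    then have "cnj (x r $ u) = ph r * cnj (x r $ v)"
      using w by (simp add: rank_one_proj_def matrix_vector_mult_axis)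
    then show ?thesis
      by (metis complex_cnj_cnj complex_cnj_mult)
  qed
  \<comment> \<open>Both sides of the eigenvalue equation for \<open>y\<close> are expanded in the
    basis, and \<open>pick\<close> compares the coefficients of \<open>x r\<close>.\<close>
  have supp: "ev r = \<theta>" if r: "r < CARD('v)" and "c r \<noteq> 0" for r
  proof -
    have pick: "(\<Sum>w\<in>UNIV. cnj (x r $ w) * (\<Sum>s<CARD('v). d s *s x s) $ w) = d r" for d
    proof -
      have "(\<Sum>w\<in>UNIV. cnj (x r $ w) * (\<Sum>s<CARD('v). d s *s x s) $ w)
          = (\<Sum>s<CARD('v). d s * (\<Sum>w\<in>UNIV. cnj (x r $ w) * x s $ w))"
        unfolding sum_component sum_distrib_left
        by (subst sum.swap) (simp add: mult.left_commute)
      also have "\<dots> = (\<Sum>s<CARD('v). d s * (if r = s then 1 else 0))"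
        using ortho[OF r] by (intro sum.cong) auto
      finally show ?thesis
        using r by (simp add: if_distrib cong: if_cong)
    qed
    have "adjacency E *v y = (\<Sum>s<CARD('v). adjacency E *v (c s *s x s))"
      by (subst expand) (rule linear_sum[OF matrix_vector_mul_linear])
    also have "\<dots> = (\<Sum>s<CARD('v). (c s * ev s) *s x s)"
      by (intro sum.cong) (auto simp: vector_scalar_commute ev)
    finally have "(\<Sum>s<CARD('v). (c s * ev s) *s x s) = \<theta> *s (\<Sum>s<CARD('v). c s *s x s)"
      using y expand by simp
    also have "\<dots> = (\<Sum>s<CARD('v). (\<theta> * c s) *s x s)"
      by (simp add: vec_eq_iff sum_distrib_left mult.assoc)
    finally have "c r * ev r = \<theta> * c r"
      using pick[of "\<lambda>s. c s * ev s"] pick[of "\<lambda>s. \<theta> * c s"] by simp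
    then show ?thesis
      using \<open>c r \<noteq> 0\<close> by simp
  qed
  \<comment> \<open>The common phase of the basis vectors occurring in \<open>y\<close>. If none
    occurs, any unit number will do and \<open>1\<close> is taken.\<close>
  have "\<exists>p. cmod p = 1 \<and> (\<forall>r<CARD('v). c r \<noteq> 0 \<longrightarrow> ph r = p)"
  proof (cases "\<exists>r<CARD('v). c r \<noteq> 0")
    case True
    then obtain r where "r < CARD('v)" "c r \<noteq> 0" by blast
    then have "ph i = ph r" if "i < CARD('v)" "c i \<noteq> 0" for i
      unfolding ph_def using supp that by (intro same) auto
    moreover have "cmod (ph r) = 1"
      by (simp add: ph_def)
    ultimately show ?thesis by blast
  qed (auto intro: exI[of _ 1])
  then obtain p where p: "cmod p = 1" "\<And>r. r < CARD('v) \<Longrightarrow> c r \<noteq> 0 \<Longrightarrow> ph r = p"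
    by blast
  have at: "y $ w = (\<Sum>r<CARD('v). c r * x r $ w)" for w
    by (subst expand) simp
  have "y $ u = cnj p * y $ v"
    unfolding at sum_distrib_left
  proof (intro sum.cong refl)
    fix r assume "r \<in> {..<CARD('v)}"
    then show "c r * x r $ u = cnj p * (c r * x r $ v)"
      using coord[of r] p(2)[of r] by (cases "c r = 0") auto
  qed
  then show ?thesis
    using p by (simp add: norm_mult)
qed

lemma transpose_adjacency:
  assumes "oriented_graph E"
  shows "transpose (adjacency E) = - adjacency E"
  using assms by (auto simp: oriented_graph_def transpose_def adjacency_def vec_eq_iff)

text \<open>By skew-symmetry a right eigenvector for \<theta> is a left eigenvector for
  \<open>- \<theta>\<close>; hence the minus sign in the exponent.\<close>

lemma transition_left_eigenvector:
  assumes "oriented_graph E" and "adjacency E *v y = \<theta> *s y"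
  shows "y v* transition E t = exp (- (of_real t * \<theta>)) *s y"
  unfolding transition_def
proof (rule mat_exp_left_eigenvector)
  have "y v* adjacency E = transpose (adjacency E) *v y"
    by simp
  also have "\<dots> = - (\<theta> *s y)"
    unfolding transpose_adjacency[OF assms(1)]
    using assms(2) by (simp add: matrix_vector_mult_def vec_eq_iff sum_negf)
  finally have "y v* adjacency E = - (\<theta> *s y)" .
  moreover have "y v* (t *\<^sub>R adjacency E) = t *\<^sub>R (y v* adjacency E)"
    by (simp add: vector_matrix_mult_def vec_eq_iff scaleR_sum_right)
  ultimately show "y v* (t *\<^sub>R adjacency E) = - (of_real t * \<theta>) *s y"
    by (simp add: vec_eq_iff scaleR_conv_of_real[where 'a = complex] mult.assoc)
qed

subsection \<open>Characters\<close>

text \<open>The properties of the characters on which the graph argument rests. Multiplicativity in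
  the index makes conjugation correspond to \<open>k \<mapsto> - k\<close>, and
  \<open>separating\<close> yields orthogonality.\<close>

locale character_pairing =
  fixes X :: "'g::{finite,ab_group_add} \<Rightarrow> 'g \<Rightarrow> complex"
  assumes add_right: "X k (x + y) = X k x * X k y"
    and add_left: "X (j + k) x = X j x * X k x"
    and norm_one: "cmod (X k x) = 1"
    and separating: "x \<noteq> 0 \<Longrightarrow> \<exists>k. X k x \<noteq> 1"
begin

lemma nonzero [simp]: "X k x \<noteq> 0"
  using norm_one[of k x] by auto

lemma zero_right [simp]: "X k 0 = 1"
  using add_right[of k 0 0] by simp

lemma zero_left [simp]: "X 0 x = 1"
  using add_left[of 0 0 x] by simp

lemma inverse_eq_cnj: "X k x * y = 1 \<Longrightarrow> y = cnj (X k x)"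
  by (metis complex_norm_square mult_cancel_left nonzero norm_one of_real_1 one_power2)

lemma minus_right: "X k (- x) = cnj (X k x)"
  using add_right[of k x "- x"] by (intro inverse_eq_cnj) simp

lemma minus_left: "X (- k) x = cnj (X k x)"
  using add_left[of k "- k" x] by (intro inverse_eq_cnj) simp

text \<open>Shifting the index by some \<open>j\<close> with \<open>X j x \<noteq> 1\<close>
  permutes the summands and yet multiplies the sum by \<open>X j x\<close>.\<close>

lemma sum_characters: "(\<Sum>k\<in>UNIV. X k x) = (if x = 0 then of_nat CARD('g) else 0)"
proof (cases "x = 0")
  case False
  then obtain j where j: "X j x \<noteq> 1"
    using separating by blast
  have "X j x * (\<Sum>k\<in>UNIV. X k x) = (\<Sum>k\<in>UNIV. X (j + k) x)"
    by (simp add: add_left sum_distrib_left)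
  also have "\<dots> = (\<Sum>k\<in>UNIV. X k x)"
    by (rule sum.reindex_bij_betw) (rule bij_plus)
  finally show ?thesis
    using j False by simp
qed simp

text \<open>Fourier inversion: summing the transform against \<open>X k (- y)\<close> over all
  \<open>k\<close> recovers \<open>f y\<close> times the group order. This is why testing against
  characters loses no information.\<close>

lemma character_transform_eq_0:
  assumes "\<And>k. (\<Sum>x\<in>UNIV. X k x * f x) = 0"
  shows "f y = 0"
proof -
  have "0 = (\<Sum>k\<in>UNIV. X k (- y) * (\<Sum>x\<in>UNIV. X k x * f x))"
    by (simp add: assms)
  also have "\<dots> = (\<Sum>x\<in>UNIV. f x * (\<Sum>k\<in>UNIV. X k (x - y)))"
    unfolding sum_distrib_left by (subst sum.swap)
      (simp only: diff_conv_add_uminus add_right mult_ac)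
  also have "\<dots> = (\<Sum>x\<in>UNIV. if x = y then of_nat CARD('g) * f x else 0)"
    by (intro sum.cong) (auto simp: sum_characters)
  finally show ?thesis
    by simp
qed

text \<open>Characters are eigenvectors of the Cayley matrix of \<open>T\<close>, with eigenvalue
  \<open>char_sum X k T\<close>; the primed version below treats the reversed edges.\<close>

lemma sum_translate: "(\<Sum>y\<in>UNIV. of_bool (- x + y \<in> T) * X k y) = X k x * char_sum X k T"
proof -
  have "(\<Sum>y\<in>UNIV. of_bool (- x + y \<in> T) * X k y) = (\<Sum>y\<in>UNIV. of_bool (y \<in> T) * X k (x + y))"
    by (subst sum.reindex_bij_betw[OF bij_plus[of x], symmetric]) simp
  also have "\<dots> = X k x * (\<Sum>y\<in>UNIV. if y \<in> T then X k y else 0)"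
    unfolding sum_distrib_left by (intro sum.cong) (auto simp: add_right)
  finally show ?thesis
    by (simp add: char_sum_def sum.If_cases)
qed

lemma char_sum_uminus: "char_sum X k (uminus ` T) = cnj (char_sum X k T)"
  by (simp add: char_sum_def sum.reindex minus_right)

lemma sum_translate': "(\<Sum>y\<in>UNIV. of_bool (- y + x \<in> T) * X k y) = X k x * cnj (char_sum X k T)"
proof -
  have "- y + x \<in> T \<longleftrightarrow> - x + y \<in> uminus ` T" for y
    by (metis (no_types, lifting) image_iff minus_add_distrib minus_minus add.commute)
  then show ?thesis
    using sum_translate[of x "uminus ` T" k] by (simp add: char_sum_uminus)
qed

lemma char_sum_minus: "char_sum X (- k) T = cnj (char_sum X k T)"
  by (simp add: char_sum_def minus_left)

lemma char_diff_minus: "char_diff X T (- k) = - char_diff X T k"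
  by (simp add: char_diff_def char_sum_minus char_sum_uminus)

lemma cnj_char_diff: "cnj (char_diff X T k) = - char_diff X T k"
  by (simp add: char_diff_def char_sum_uminus)

lemma Re_char_diff: "Re (char_diff X T k) = 0"
  by (simp add: char_diff_def char_sum_uminus)

end

section \<open>The characters of a direct sum of cyclic groups\<close>

lemma power_int_root_of_unity_mod:
  assumes "0 < m"
  shows "exp (2 * of_real pi * \<i> / of_nat m) powi (a * (b mod int m)) =
    exp (2 * of_real pi * \<i> / of_nat m) powi (a * b)"
proof -
  have root: "exp (2 * of_real pi * \<i> / of_nat m) powi (int m * c) = 1" for c
  proof -
    have "of_int (int m * c) * (2 * of_real pi * \<i> / of_nat m) = 2 * of_int c * of_real pi * \<i>"
      using assms by (simp add: field_simps)
    then show ?thesis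
      unfolding exp_power_int exp_eq_1 by (auto intro: exI[of _ c])
  qed
  have "a * b = a * (b mod int m) + int m * (a * (b div int m))"
    by (metis distrib_left mod_mult_div_eq mult.left_commute)
  then show ?thesis
    by (simp add: power_int_add root)
qed

text \<open>Coordinates under \<phi> add only modulo \<open>m s\<close>, which is harmless in
  exponents of roots of unity. A nonzero element is separated from \<open>0\<close> by a single
  coordinate.\<close>

lemma character_pairing_group_char:
  fixes \<phi> :: "'g::{finite,ab_group_add} \<Rightarrow> nat \<Rightarrow> int"
  assumes "cyclic_decomposition p m \<phi>"
  shows "character_pairing (group_char p m \<phi>)"
proof -
  let ?P = "product_group {..<p} (\<lambda>s. integer_mod_group (m s))"
  have m: "0 < m s" if "s < p" for s
    using assms that by (simp add: cyclic_decomposition_def)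
  have iso: "\<phi> \<in> iso additive_group ?P"
    using assms by (simp add: cyclic_decomposition_def)
  have bij: "bij_betw \<phi> UNIV (carrier ?P)"
    using iso by (simp add: iso_def additive_group_def)
  have hom: "\<phi> (x + y) s = (\<phi> x s + \<phi> y s) mod int (m s)" if "s < p" for x y s
    using iso that by (simp add: iso_def hom_def additive_group_def)
  have range: "\<phi> x \<in> (\<Pi>\<^sub>E s\<in>{..<p}. {0..<int (m s)})" for x
  proof -
    have "\<phi> x \<in> carrier ?P"
      using bij by (auto simp: bij_betw_def)
    then show ?thesis
      unfolding carrier_product_group
      by (rule subsetD[OF PiE_mono, rotated]) (use m in \<open>auto simp: carrier_integer_mod_group\<close>)
  qed
  have bound: "0 \<le> \<phi> x s \<and> \<phi> x s < int (m s)" if "s < p" for x s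
    using range[of x] that by (auto simp: PiE_iff)
  show ?thesis
  proof
    fix k x y :: 'g
    show "group_char p m \<phi> k (x + y) = group_char p m \<phi> k x * group_char p m \<phi> k y"
      unfolding group_char_def prod.distrib[symmetric]
      by (intro prod.cong) (auto simp: hom power_int_root_of_unity_mod m power_int_add distrib_left)
    \<comment> \<open>The exponents are symmetric in the two arguments, so additivity in the index
      is the same computation.\<close>
    show "group_char p m \<phi> (x + y) k = group_char p m \<phi> x k * group_char p m \<phi> y k"
      unfolding group_char_def prod.distrib[symmetric] mult.commute[of "\<phi> _ _" "\<phi> k _"]
      by (intro prod.cong) (auto simp: hom power_int_root_of_unity_mod m power_int_add distrib_left)
    show "cmod (group_char p m \<phi> k x) = 1"
      by (simp add: group_char_def prod_norm[symmetric] norm_power_int)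
    assume "x \<noteq> 0"
    then have "\<phi> x \<noteq> \<phi> 0"
      using bij by (auto simp: bij_betw_def inj_on_def)
    then obtain s where s: "s < p" "\<phi> x s \<noteq> \<phi> 0 s"
      using range[of x] range[of 0] by (metis PiE_ext lessThan_iff)
    have "\<phi> 0 s = 0"
    proof -
      have "(\<phi> 0 s + \<phi> 0 s) mod int (m s) = \<phi> 0 s mod int (m s)"
        using hom[OF s(1), of 0 0] bound[OF s(1), of 0] by simp
      then have "int (m s) dvd \<phi> 0 s"
        by (simp add: mod_eq_dvd_iff)
      then show ?thesis
        using bound[OF s(1), of 0] by (auto dest: zdvd_imp_le)
    qed
    with s bound[OF s(1), of x] have x: "0 < \<phi> x s" "\<phi> x s < int (m s)"
      by auto
    \<comment> \<open>The unit vector at a coordinate where \<open>x\<close> is nonzero. There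
      \<open>0 < \<phi> x s < m s\<close> forces \<open>m s > 1\<close>, so \<open>1\<close> is a
      legal coordinate, and the character with index \<open>e\<close> takes the value of the root of
      unity to the power \<open>\<phi> x s\<close>.\<close>
    define e where "e = (\<lambda>i\<in>{..<p}. if i = s then 1 else 0 :: int)"
    have "e \<in> carrier ?P"
      using m x by (auto simp: e_def PiE_iff carrier_integer_mod_group)
    then obtain k where k: "\<phi> k = e"
      using bij by (metis bij_betw_imp_surj_on imageE)
    have "group_char p m \<phi> k x = (\<Prod>i<p. if i = s then exp (2 * of_real pi * \<i> / of_nat (m s)) powi \<phi> x s else 1)"
      unfolding group_char_def k by (intro prod.cong) (auto simp: e_def)
    then have eq: "group_char p m \<phi> k x = exp (of_int (\<phi> x s) * (2 * of_real pi * \<i> / of_nat (m s)))"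
      using s(1) by (simp add: exp_power_int)
    have "group_char p m \<phi> k x \<noteq> 1"
    proof
      assume "group_char p m \<phi> k x = 1"
      then obtain j :: int where "of_int (\<phi> x s) * (2 * pi / of_nat (m s)) = of_int (2 * j) * pi"
        unfolding eq exp_eq_1 by auto
      then have "real_of_int (\<phi> x s) = of_int (j * int (m s))"
        using m[OF s(1)] by (simp add: field_simps)
      then have "\<phi> x s = j * int (m s)"
        by (simp only: of_int_eq_iff)
      then show False
        using x by (metis mod_mult_self2_is_0 mod_pos_pos_trivial less_imp_le less_irrefl)
    qed
    then show "\<exists>k. group_char p m \<phi> k x \<noteq> 1"
      by blast
  qed
qed

subsection \<open>Oriented semi-Cayley graphs\<close>

text \<open>\<open>exhaust_2\<close> and \<open>sum_2\<close> name the elements \<open>1\<close> and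
  \<open>2\<close>, whereas vertices are labelled \<open>0\<close> and \<open>1\<close>.\<close>

lemma two_eq_zero_mod_2: "(2::2) = 0"
  using exhaust_2[of 0] by auto

lemma sum_UNIV_times_2:
  fixes F :: "'g::finite \<times> 2 \<Rightarrow> 'a::comm_monoid_add"
  shows "(\<Sum>w\<in>UNIV. F w) = (\<Sum>x\<in>UNIV. F (x, 0)) + (\<Sum>x\<in>UNIV. F (x, 1))"
proof -
  have "(\<Sum>w\<in>UNIV. F w) = (\<Sum>x\<in>UNIV. \<Sum>a\<in>UNIV. F (x, a))"
    by (simp add: sum.cartesian_product)
  also have "\<dots> = (\<Sum>x\<in>UNIV. F (x, 0) + F (x, 1))"
    by (simp add: sum_2 two_eq_zero_mod_2 add.commute)
  finally show ?thesis
    by (simp add: sum.distrib)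
qed

text \<open>Since \<open>R\<close> and \<open>L\<close> are disjoint from their inverses, at most
  one orientation of an edge inside a layer is present and the case distinction becomes a difference
  of indicators. Edges from \<open>S\<close> only run from layer \<open>0\<close> to layer
  \<open>1\<close>.\<close>

lemma adjacency_OSC:
  fixes R L S :: "'g::{finite,ab_group_add} set"
  assumes "R \<inter> uminus ` R = {}" "L \<inter> uminus ` L = {}"
  shows "adjacency (OSC R L S) $ (x, 0) $ (y, 0) = of_bool (- x + y \<in> R) - of_bool (- y + x \<in> R)"
    and "adjacency (OSC R L S) $ (x, 1) $ (y, 1) = of_bool (- x + y \<in> L) - of_bool (- y + x \<in> L)"
    and "adjacency (OSC R L S) $ (x, 0) $ (y, 1) = of_bool (- x + y \<in> S)"
    and "adjacency (OSC R L S) $ (x, 1) $ (y, 0) = - of_bool (- y + x \<in> S)"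
proof -
  have "\<not> (- x + y \<in> T \<and> - y + x \<in> T)" if "T \<inter> uminus ` T = {}" for T
  proof
    assume "- x + y \<in> T \<and> - y + x \<in> T"
    then have "- x + y \<in> T" "- (- y + x) \<in> uminus ` T"
      by blast+
    then show False
      using that by auto
  qed
  from this[OF assms(1)] this[OF assms(2)] show
    "adjacency (OSC R L S) $ (x, 0) $ (y, 0) = of_bool (- x + y \<in> R) - of_bool (- y + x \<in> R)"
    "adjacency (OSC R L S) $ (x, 1) $ (y, 1) = of_bool (- x + y \<in> L) - of_bool (- y + x \<in> L)"
    "adjacency (OSC R L S) $ (x, 0) $ (y, 1) = of_bool (- x + y \<in> S)"
    "adjacency (OSC R L S) $ (x, 1) $ (y, 0) = - of_bool (- y + x \<in> S)"
    by (auto simp: adjacency_def OSC_def)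
qed

section \<open>Bloch vectors: the planes attached to the characters and invariant under the
  adjacency matrix\<close>

definition bloch_vector ::
    "('g \<Rightarrow> 'g \<Rightarrow> complex) \<Rightarrow> 'g \<Rightarrow> complex \<Rightarrow> complex \<Rightarrow> complex ^ ('g::finite \<times> 2)" where
  "bloch_vector X k a b = (\<chi> w. (if snd w = 0 then a else b) * X k (fst w))"

lemma bloch_vector_component [simp]:
  "bloch_vector X k a b $ (x, 0) = a * X k x"
  "bloch_vector X k a b $ (x, 1) = b * X k x"
  by (simp_all add: bloch_vector_def)

lemma vec_eq_iff_times_2:
  fixes v w :: "'a ^ ('g::finite \<times> 2)"
  shows "v = w \<longleftrightarrow> (\<forall>x. v $ (x, 0) = w $ (x, 0) \<and> v $ (x, 1) = w $ (x, 1))"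
proof
  assume *: "\<forall>x. v $ (x, 0) = w $ (x, 0) \<and> v $ (x, 1) = w $ (x, 1)"
  have "v $ (x, a) = w $ (x, a)" for x a
    using * exhaust_2[of a] unfolding two_eq_zero_mod_2 by auto
  then show "v = w"
    by (auto simp: vec_eq_iff)
qed simp

context character_pairing
begin

lemma adjacency_OSC_bloch:
  assumes "R \<inter> uminus ` R = {}" "L \<inter> uminus ` L = {}"
  shows "adjacency (OSC R L S) *v bloch_vector X k a b =
    bloch_vector X k (a * char_diff X R k + b * char_sum X k S)
      (b * char_diff X L k - a * cnj (char_sum X k S))"
proof -
  have T: "(\<Sum>y\<in>UNIV. (of_bool (- x + y \<in> T) - of_bool (- y + x \<in> T)) * (a * X k y))
      = a * (X k x * char_diff X T k)" for T a x
  proof -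
    have "(\<Sum>y\<in>UNIV. (of_bool (- x + y \<in> T) - of_bool (- y + x \<in> T)) * (a * X k y))
      = a * ((\<Sum>y\<in>UNIV. of_bool (- x + y \<in> T) * X k y) - (\<Sum>y\<in>UNIV. of_bool (- y + x \<in> T) * X k y))"
      by (simp only: sum_subtractf[symmetric] sum_distrib_left left_diff_distrib right_diff_distrib mult_ac)
    then show ?thesis
      unfolding sum_translate sum_translate' by (simp add: char_diff_def char_sum_uminus right_diff_distrib)
  qed
  have S: "(\<Sum>y\<in>UNIV. of_bool (- x + y \<in> S) * (b * X k y)) = b * (X k x * char_sum X k S)" for b x
    unfolding sum_translate[symmetric] by (simp only: sum_distrib_left mult_ac)
  have S': "(\<Sum>y\<in>UNIV. - of_bool (- y + x \<in> S) * (a * X k y)) = - a * (X k x * cnj (char_sum X k S))" for a x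
    unfolding sum_translate'[symmetric] sum_distrib_left by (intro sum.cong) auto
  show ?thesis
    unfolding vec_eq_iff_times_2 matrix_vector_mult_def vec_lambda_beta sum_UNIV_times_2
      adjacency_OSC[OF assms] bloch_vector_component T S S'
    by (simp add: algebra_simps)
qed

lemma strongly_cospectral_OSC:
  assumes RL: "R \<inter> uminus ` R = {}" "L \<inter> uminus ` L = {}"
    and sc: "strongly_cospectral (OSC R L S) (g, 0) (h, 1)"
  shows "char_sum X k S \<noteq> 0" and "char_diff X R k = char_diff X L k"
proof -
  let ?s = "char_sum X k S"
  have modulus: "cmod a = cmod b"
    if "a * char_diff X R k + b * ?s = \<theta> * a" "b * char_diff X L k - a * cnj ?s = \<theta> * b" for a b \<theta>
  proof -
    have "adjacency (OSC R L S) *v bloch_vector X k a b = \<theta> *s bloch_vector X k a b"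
      unfolding adjacency_OSC_bloch[OF RL] that by (simp add: vec_eq_iff_times_2)
    from strongly_cospectral_eigenvector[OF sc this] show ?thesis
      by (simp add: norm_mult norm_one)
  qed
  \<comment> \<open>If the character sum vanished, the block would be diagonal with eigenvector
    \<open>(1, 0)\<close>, whose entries have different moduli.\<close>
  show s: "?s \<noteq> 0"
    using modulus[of 1 0 "char_diff X R k"] by auto
  \<comment> \<open>The diagonal entries of the block are purely imaginary, so its eigenvalues come
    from a real quadratic.\<close>
  define \<rho> \<mu> \<sigma> where "\<rho> = Im (char_diff X R k)" and "\<mu> = Im (char_diff X L k)" and "\<sigma> = cmod ?s"
  have r: "char_diff X R k = \<i> * \<rho>" and l: "char_diff X L k = \<i> * \<mu>"
    by (simp_all add: complex_eq_iff \<rho>_def \<mu>_def Re_char_diff)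
  have ss: "?s * cnj ?s = \<sigma>\<^sup>2"
    by (simp add: \<sigma>_def complex_norm_square[symmetric])
  \<comment> \<open>\<open>\<i> * \<tau>\<close> is an eigenvalue of the block of \<open>k\<close>; equal moduli of its eigenvector \<open>(?s, \<i> * (\<tau> - \<rho>))\<close>
    together with \<open>(\<tau> - \<rho>) * (\<tau> - \<mu>) = \<sigma>\<^sup>2\<close> force \<open>\<rho> = \<mu>\<close>.\<close>
  define d where "d = sqrt ((\<rho> - \<mu>)\<^sup>2 + 4 * \<sigma>\<^sup>2)"
  define \<tau> where "\<tau> = (\<rho> + \<mu> + d) / 2"
  have "d\<^sup>2 = (\<rho> - \<mu>)\<^sup>2 + 4 * \<sigma>\<^sup>2"
    by (simp add: d_def)
  then have \<tau>: "(\<tau> - \<rho>) * (\<tau> - \<mu>) = \<sigma>\<^sup>2"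
    unfolding \<tau>_def by (simp add: field_simps power2_eq_square)
  have "cmod ?s = cmod (\<i> * of_real (\<tau> - \<rho>))"
  proof (rule modulus)
    show "?s * char_diff X R k + \<i> * of_real (\<tau> - \<rho>) * ?s = \<i> * of_real \<tau> * ?s"
      unfolding r by (simp add: algebra_simps)
    have "\<i> * of_real (\<tau> - \<rho>) * (\<i> * of_real \<mu>) - of_real (\<sigma>\<^sup>2) = \<i> * of_real \<tau> * (\<i> * of_real (\<tau> - \<rho>))"
      unfolding \<tau>[symmetric] by (simp add: algebra_simps)
    then show "\<i> * of_real (\<tau> - \<rho>) * char_diff X L k - ?s * cnj ?s = \<i> * of_real \<tau> * (\<i> * of_real (\<tau> - \<rho>))"
      unfolding l ss .
  qed
  then have \<sigma>: "\<sigma> = \<bar>\<tau> - \<rho>\<bar>"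
    unfolding \<sigma>_def norm_mult norm_of_real by simp
  then have "(\<tau> - \<rho>) * (\<tau> - \<mu>) = (\<tau> - \<rho>) * (\<tau> - \<rho>)"
    unfolding \<tau> by (simp add: power2_eq_square)
  moreover have "\<tau> - \<rho> \<noteq> 0"
    using \<sigma> s by (auto simp: \<sigma>_def)
  ultimately show "char_diff X R k = char_diff X L k"
    unfolding r l by simp
qed

end

subsection \<open>Fractional revival\<close>

text \<open>An equation between vectors is tested against eigenvectors, two for each
  \<open>k\<close>, which together span the space. The pairing is bilinear, without conjugation,
  because they act as left eigenvectors.\<close>

lemma (in character_pairing) transition_OSC_iff:
  assumes RL: "R \<inter> uminus ` R = {}" "L \<inter> uminus ` L = {}"
    and s: "\<And>k. char_sum X k S \<noteq> 0"
    and rl: "\<And>k. char_diff X R k = char_diff X L k"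
  shows "transition (OSC R L S) t *v axis (g, 0) 1 =
      of_real \<alpha> *s axis (g, 0) 1 + of_real \<beta> *s axis (h, 1) 1 \<longleftrightarrow>
    (\<forall>k. \<forall>\<epsilon>\<in>{1, -1}.
      exp (- (of_real t * (char_diff X R k + \<i> * \<epsilon> * of_real (cmod (char_sum X k S))))) =
      of_real \<alpha> + \<i> * \<epsilon> * of_real \<beta> * sgn (cnj (char_sum X k S) * X k (- g + h)))"
    (is "?fr \<longleftrightarrow> (\<forall>k. \<forall>\<epsilon>\<in>{1, -1}. ?eq k \<epsilon>)")
proof -
  let ?U = "transition (OSC R L S) t *v axis (g, 0) 1"
  let ?V = "of_real \<alpha> *s axis (g, 0) 1 + of_real \<beta> *s axis (h, 1) 1 :: complex ^ ('g \<times> 2)"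
  define s where "s k = char_sum X k S" for k
  define \<theta> where "\<theta> k \<epsilon> = char_diff X R k + \<i> * \<epsilon> * of_real (cmod (s k))" for k \<epsilon>
  \<comment> \<open>With equal diagonal entries the block has eigenvectors
    \<open>(s, \<i> * \<epsilon> * \<bar>s\<bar>)\<close> for the two signs \<epsilon>.\<close>
  define y where "y k \<epsilon> = bloch_vector X k (s k) (\<i> * \<epsilon> * of_real (cmod (s k)))" for k \<epsilon>
  have s0 [simp]: "s k \<noteq> 0" for k
    using s by (simp add: s_def)
  have ss: "s k * cnj (s k) = of_real (cmod (s k)) * of_real (cmod (s k))" for k
    by (simp add: complex_norm_square[symmetric] power2_eq_square)
  have sgn: "sgn (cnj (s k) * X k (- g + h)) = of_real (cmod (s k)) / s k * (X k h / X k g)" for k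
  proof -
    have "X k (- g + h) = X k h / X k g"
      using add_right[of k g "- g + h"] by (simp add: field_simps)
    moreover have "cnj (s k) / of_real (cmod (s k)) = of_real (cmod (s k)) / s k"
      using ss[of k] by (simp add: field_simps)
    ultimately show ?thesis
      by (simp add: sgn_eq norm_mult norm_divide norm_one field_simps)
  qed
  have eig: "adjacency (OSC R L S) *v y k \<epsilon> = \<theta> k \<epsilon> *s y k \<epsilon>" if "\<epsilon> \<in> {1, -1}" for k \<epsilon>
  proof -
    have "\<epsilon> * \<epsilon> = 1"
      using that by auto
    then have sq: "\<i> * \<epsilon> * of_real (cmod (s k)) * (\<i> * \<epsilon> * of_real (cmod (s k))) = - (s k * cnj (s k))"
      unfolding ss by (simp add: algebra_simps)
    show ?thesis
      unfolding y_def adjacency_OSC_bloch[OF RL]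
      using sq by (simp add: vec_eq_iff_times_2 \<theta>_def rl s_def[symmetric] algebra_simps)
  qed
  have U: "(\<Sum>w\<in>UNIV. y k \<epsilon> $ w * ?U $ w) = exp (- (of_real t * \<theta> k \<epsilon>)) * (s k * X k g)"
    if "\<epsilon> \<in> {1, -1}" for k \<epsilon>
  proof -
    have "(\<Sum>w\<in>UNIV. y k \<epsilon> $ w * ?U $ w) = (y k \<epsilon> v* transition (OSC R L S) t) $ (g, 0)"
      by (simp add: matrix_vector_mult_axis vector_matrix_mult_def)
    then show ?thesis
      unfolding transition_left_eigenvector[OF oriented_graph_OSC[OF RL] eig[OF that]]
      by (simp add: y_def)
  qed
  have V: "(\<Sum>w\<in>UNIV. y k \<epsilon> $ w * ?V $ w) =
      of_real \<alpha> * (s k * X k g) + of_real \<beta> * (\<i> * \<epsilon> * of_real (cmod (s k)) * X k h)" for k \<epsilon>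
  proof -
    have ax: "(\<Sum>w\<in>UNIV. y k \<epsilon> $ w * axis v 1 $ w) = y k \<epsilon> $ v" for v
      by (simp add: axis_def if_distrib cong: if_cong)
    have "(\<Sum>w\<in>UNIV. y k \<epsilon> $ w * ?V $ w) = of_real \<alpha> * (\<Sum>w\<in>UNIV. y k \<epsilon> $ w * axis (g, 0) 1 $ w) +
        of_real \<beta> * (\<Sum>w\<in>UNIV. y k \<epsilon> $ w * axis (h, 1) 1 $ w)"
      by (simp add: sum_distrib_left sum.distrib[symmetric] algebra_simps)
    then show ?thesis
      unfolding ax by (simp add: y_def)
  qed
  \<comment> \<open>Division by the nonzero factor \<open>s k * X k g\<close> normalizes the tested
    equation; by \<open>sgn\<close> the remaining quotient is the phase.\<close>
  have iff: "(\<Sum>w\<in>UNIV. y k \<epsilon> $ w * ?U $ w) = (\<Sum>w\<in>UNIV. y k \<epsilon> $ w * ?V $ w) \<longleftrightarrow> ?eq k \<epsilon>"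
    if "\<epsilon> \<in> {1, -1}" for k \<epsilon>
    unfolding U[OF that] V s_def[symmetric] \<theta>_def[symmetric] sgn
    by (simp add: field_simps)
  show ?thesis
  proof
    assume ?fr
    then show "\<forall>k. \<forall>\<epsilon>\<in>{1, -1}. ?eq k \<epsilon>"
      using iff by metis
  next
    assume *: "\<forall>k. \<forall>\<epsilon>\<in>{1, -1}. ?eq k \<epsilon>"
    define f where "f = ?U - ?V"
    have f: "(\<Sum>w\<in>UNIV. y k \<epsilon> $ w * f $ w) = 0" if "\<epsilon> \<in> {1, -1}" for k \<epsilon>
    proof -
      have "(\<Sum>w\<in>UNIV. y k \<epsilon> $ w * ?U $ w) = (\<Sum>w\<in>UNIV. y k \<epsilon> $ w * ?V $ w)"
        using iff[OF that] * that by blast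
      then show ?thesis
        unfolding f_def vector_minus_component right_diff_distrib sum_subtractf by simp
    qed
    have split: "s k * (\<Sum>x\<in>UNIV. X k x * f $ (x, 0)) +
        \<i> * \<epsilon> * of_real (cmod (s k)) * (\<Sum>x\<in>UNIV. X k x * f $ (x, 1)) = 0"
      if "\<epsilon> \<in> {1, -1}" for k \<epsilon>
      using f[OF that, of k] by (simp add: sum_UNIV_times_2 y_def sum_distrib_left mult.assoc)
    \<comment> \<open>Adding and subtracting the equations for the two signs separates the layers,
      after which Fourier inversion applies to each layer.\<close>
    have "(\<Sum>x\<in>UNIV. X k x * f $ (x, 0)) = 0 \<and> (\<Sum>x\<in>UNIV. X k x * f $ (x, 1)) = 0" for k
    proof -
      have solve: "a = 0 \<and> b = 0" if "a + b = 0" "a - b = 0" for a b :: complex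
        using that by (auto simp: mult_2[symmetric])
      have "s k * (\<Sum>x\<in>UNIV. X k x * f $ (x, 0)) = 0 \<and>
          \<i> * of_real (cmod (s k)) * (\<Sum>x\<in>UNIV. X k x * f $ (x, 1)) = 0"
        using split[of 1 k] split[of "-1" k] by (intro solve) simp_all
      then show ?thesis
        by simp
    qed
    then have "f $ (x, 0) = 0 \<and> f $ (x, 1) = 0" for x
      using character_transform_eq_0[of "\<lambda>x. f $ (x, 0)"] character_transform_eq_0[of "\<lambda>x. f $ (x, 1)"]
      by blast
    then have "f = 0"
      by (simp add: vec_eq_iff_times_2)
    then show ?fr
      by (simp add: f_def)
  qed
qed

section \<open>Complex arithmetic of the revival equations\<close>

lemma sgn_eq_signed_unit_iff:
  fixes w :: complex
  assumes "w \<noteq> 0"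
  shows "sgn w = 1 \<longleftrightarrow> w = of_real (cmod w)" and "sgn w = - 1 \<longleftrightarrow> w = - of_real (cmod w)"
  using assms by (auto simp: sgn_eq field_simps)

text \<open>Adding the two equations gives \<open>e * cos x = \<alpha>\<close>, so \<open>e\<close>
  is real because \<alpha> is real and nonzero; then \<open>\<beta> * z = - e * sin x\<close> makes
  the unit number \<open>z\<close> real. It is applied with \<open>e = exp (- t r\<^sub>k)\<close>
  and \<open>x\<close> equal to \<open>t\<close> times the modulus of the character sum.\<close>

lemma revival_phase_real:
  fixes z e :: complex and \<alpha> \<beta> x :: real
  assumes "\<alpha> \<noteq> 0" "\<beta> \<noteq> 0" "cmod z = 1"
    and eq: "\<forall>\<epsilon>\<in>{1, -1}. e * exp (- (\<i> * \<epsilon> * of_real x)) = of_real \<alpha> + \<i> * \<epsilon> * of_real \<beta> * z"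
  shows "z = 1 \<or> z = - 1"
proof -
  have plus: "e * (of_real (cos x) - \<i> * of_real (sin x)) = of_real \<alpha> + \<i> * of_real \<beta> * z"
    using eq[THEN bspec, of 1] by (simp add: exp_minus_Euler[of "of_real x"] cos_of_real sin_of_real)
  have minus: "e * (of_real (cos x) + \<i> * of_real (sin x)) = of_real \<alpha> - \<i> * of_real \<beta> * z"
    using eq[THEN bspec, of "-1"] by (simp add: exp_Euler[of "of_real x"] cos_of_real sin_of_real)
  have c: "e * of_real (cos x) = of_real \<alpha>"
    using arg_cong2[OF plus minus, of "(+)"] by (simp add: algebra_simps)
  have "\<i> * (of_real \<beta> * z + e * of_real (sin x)) = 0"
    using plus c by (simp add: algebra_simps)
  then have sn: "of_real \<beta> * z = - e * of_real (sin x)"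
    by (simp add: eq_neg_iff_add_eq_0)
  have "cos x \<noteq> 0"
    using c \<open>\<alpha> \<noteq> 0\<close> by auto
  then have "Im e = 0"
    using arg_cong[OF c, of Im] by simp
  then have "\<beta> * Im z = 0"
    using arg_cong[OF sn, of Im] by simp
  then have "Im z = 0"
    using \<open>\<beta> \<noteq> 0\<close> by simp
  then show ?thesis
    using \<open>cmod z = 1\<close> by (auto simp: cmod_eq_Re complex_eq_iff abs_if split: if_splits)
qed

text \<open>The hypothesis is the equation for \<open>\<epsilon> = z\<close>; as \<open>e\<close> is
  real, conjugating it gives the one for \<open>\<epsilon> = - z\<close>.\<close>

lemma revival_equation_of_real_phase:
  fixes e z :: complex and \<alpha> \<beta> x :: real
  assumes "z = 1 \<or> z = - 1" "cnj e = e"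
    and eq: "e * exp (- (\<i> * z * of_real x)) = of_real \<alpha> + \<i> * of_real \<beta>"
  shows "\<forall>\<epsilon>\<in>{1, -1}. e * exp (- (\<i> * \<epsilon> * of_real x)) = of_real \<alpha> + \<i> * \<epsilon> * of_real \<beta> * z"
proof -
  obtain c where c: "e = of_real c"
    using assms(2) by (metis Reals_cases Reals_cnj_iff)
  have "e * exp (\<i> * z * of_real x) = cnj (e * exp (- (\<i> * z * of_real x)))"
    using assms(1) by (auto simp: c exp_cnj)
  also have "\<dots> = of_real \<alpha> - \<i> * of_real \<beta>"
    unfolding eq by simp
  finally show ?thesis
    using assms(1) eq by auto
qed

lemma exp_eq_iff_diff_multiple:
  fixes a b :: complex
  shows "exp a = exp b \<longleftrightarrow> (\<exists>j::int. a - b = 2 * of_real pi * \<i> * of_int j)"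
proof -
  have "exp a = exp b \<longleftrightarrow> (\<exists>j::int. a = b + (of_int (2 * j) * pi) * \<i>)"
    by (rule exp_eq)
  also have "\<dots> \<longleftrightarrow> (\<exists>j::int. a - b = 2 * of_real pi * \<i> * of_int j)"
    by (intro ex_cong1) (auto simp: algebra_simps)
  finally show ?thesis .
qed

text \<open>For equal diagonal entries the discriminant is minus four times the squared modulus of
  the character sum.\<close>

lemma eig_plus_minus_eq:
  assumes "char_diff X R k = char_diff X L k" "char_sum X k S \<noteq> 0"
  shows "eig_plus X R L S k = char_diff X R k + \<i> * of_real (cmod (char_sum X k S))"
    and "eig_minus X R L S k = char_diff X R k - \<i> * of_real (cmod (char_sum X k S))"
proof -
  have "cmod (csqrt ((char_diff X L k - char_diff X R k)\<^sup>2 - 4 * (of_real (cmod (char_sum X k S)))\<^sup>2))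
      = 2 * cmod (char_sum X k S)"
    by (simp add: assms(1) norm_mult norm_power real_sqrt_mult)
  then show "eig_plus X R L S k = char_diff X R k + \<i> * of_real (cmod (char_sum X k S))"
    "eig_minus X R L S k = char_diff X R k - \<i> * of_real (cmod (char_sum X k S))"
    unfolding eig_plus_def eig_minus_def Let_def using assms by (simp_all add: add_divide_distrib diff_divide_distrib)
qed

theorem theorem4p7:
  fixes R L S :: "'g::{finite,ab_group_add} set"
    and n p :: nat
    and m :: "nat \<Rightarrow> nat"
    and \<phi> :: "'g \<Rightarrow> nat \<Rightarrow> int"
    and X :: "'g \<Rightarrow> 'g \<Rightarrow> complex"
    and g h :: 'g
    and K1 K2 :: "'g set"
    and \<alpha> \<beta> t :: real
  assumes "CARD('g) = n"
    and "cyclic_decomposition p m \<phi>"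
    and "X = group_char p m \<phi>"
    and "R \<inter> uminus ` R = {}" and "L \<inter> uminus ` L = {}" and "0 \<notin> R \<union> L"
    and "strongly_cospectral (OSC R L S) (g, 0) (h, 1)"
    and "\<alpha> \<noteq> 0" and "\<beta> \<noteq> 0"
    and "K1 = {k. cnj (char_sum X k S) * X k (- g + h) = of_real (cmod (char_sum X k S))}"
    and "K2 = {k. cnj (char_sum X k S) * X k (- g + h) = - of_real (cmod (char_sum X k S))}"
  shows "fractional_revival (OSC R L S) \<alpha> \<beta> (g, 0) (h, 1) t \<longleftrightarrow>
           UNIV = K1 \<union> K2 \<and>
           (\<forall>k1\<in>K1. \<exists>j::int. (eig_plus X R L S k1 - eig_plus X R L S 0) * of_real t
                              = 2 * of_real pi * \<i> * of_int j) \<and>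
           (\<forall>k2\<in>K2. \<exists>j::int. (eig_minus X R L S k2 - eig_plus X R L S 0) * of_real t
                              = 2 * of_real pi * \<i> * of_int j) \<and>
           \<alpha> = Re (exp (of_real t * eig_plus X R L S 0)) \<and>
           \<beta> = - Im (exp (of_real t * eig_plus X R L S 0))"
proof -
  interpret character_pairing X
    unfolding \<open>X = _\<close> by (rule character_pairing_group_char) fact
  note RL = \<open>R \<inter> uminus ` R = {}\<close> \<open>L \<inter> uminus ` L = {}\<close>
  note sc = \<open>strongly_cospectral (OSC R L S) (g, 0) (h, 1)\<close>
  define r where "r k = char_diff X R k" for k
  define c where "c k = cmod (char_sum X k S)" for k
  define z where "z k = sgn (cnj (char_sum X k S) * X k (- g + h))" for k
  have s: "char_sum X k S \<noteq> 0" and rl: "char_diff X R k = char_diff X L k" for k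
    using strongly_cospectral_OSC[OF RL sc] by auto
  have norm_z: "cmod (z k) = 1" for k
    using s by (simp add: z_def norm_sgn)
  have K1: "k \<in> K1 \<longleftrightarrow> z k = 1" and K2: "k \<in> K2 \<longleftrightarrow> z k = - 1" for k
    using sgn_eq_signed_unit_iff[of "cnj (char_sum X k S) * X k (- g + h)"] s
    unfolding \<open>K1 = _\<close> \<open>K2 = _\<close> z_def by (simp_all add: norm_mult norm_one)
  have plus: "eig_plus X R L S k = r k + \<i> * of_real (c k)"
    and minus: "eig_minus X R L S k = r k - \<i> * of_real (c k)" for k
    unfolding r_def c_def by (rule eig_plus_minus_eq[OF rl s])+
  have r_minus: "r (- k) = - r k" and c_minus: "c (- k) = c k" and z_minus: "z (- k) = cnj (z k)" for k
    by (simp_all add: r_def c_def z_def char_diff_minus char_sum_minus minus_left sgn_eq norm_mult)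
  have cnj_r: "cnj (r k) = - r k" for k
    by (simp add: r_def cnj_char_diff)
  \<comment> \<open>The eigenvalues are purely imaginary, so the negative exponents of the revival
    equations become conjugates. This is the source of the sign in
    \<open>\<beta> = - Im ...\<close>.\<close>
  have cnj_exp: "exp (- (of_real t * (r k + \<i> * \<epsilon> * of_real (c k)))) =
      cnj (exp (of_real t * (r k + \<i> * \<epsilon> * of_real (c k))))" if "\<epsilon> \<in> {1, -1}" for k \<epsilon>
    using that by (auto simp: exp_cnj cnj_r algebra_simps)
  have split: "exp (- (of_real t * (r k + \<i> * \<epsilon> * of_real (c k)))) =
      exp (- (of_real t * r k)) * exp (- (\<i> * \<epsilon> * of_real (t * c k)))" for k \<epsilon>
    by (simp add: exp_add[symmetric] algebra_simps)
  \<comment> \<open>At the trivial character the sum is the cardinality of \<open>S\<close>, so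
    \<open>0\<close> lies in \<open>K1\<close>; this explains why \<open>eig_plus\<close> at
    \<open>0\<close> is the reference eigenvalue.\<close>
  have z0: "z 0 = 1"
    using s[of 0] by (simp add: z_def char_sum_def sgn_eq)
  define revival where "revival k \<longleftrightarrow> (\<forall>\<epsilon>\<in>{1, -1}.
      exp (- (of_real t * r k)) * exp (- (\<i> * \<epsilon> * of_real (t * c k))) =
      of_real \<alpha> + \<i> * \<epsilon> * of_real \<beta> * z k)" for k
  have fr: "fractional_revival (OSC R L S) \<alpha> \<beta> (g, 0) (h, 1) t \<longleftrightarrow>
      \<alpha>\<^sup>2 + \<beta>\<^sup>2 = 1 \<and> (\<forall>k. revival k)"
    unfolding fractional_revival_def revival_def transition_OSC_iff[OF RL s rl]
      r_def[symmetric] c_def[symmetric] z_def[symmetric] split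
    using \<open>\<beta> \<noteq> 0\<close> by simp
  \<comment> \<open>\<open>?w\<close> is the value that the formulas for \<alpha> and \<beta>
    prescribe for the exponential at \<open>0\<close>. For \<open>k\<close> in \<open>K1\<close> or
    \<open>K2\<close>, \<open>?E k\<close> uses \<open>eig_plus\<close> or \<open>eig_minus\<close>
    respectively.\<close>
  let ?w = "of_real \<alpha> - \<i> * of_real \<beta> :: complex"
  let ?E = "\<lambda>k. exp (of_real t * (r k + \<i> * z k * of_real (c k)))"
  \<comment> \<open>The revival equation is taken at \<open>\<epsilon> = z k\<close>, where
    \<open>\<epsilon> * z k = 1\<close>.\<close>
  have phase: "?E k = ?w" if "revival k" "z k = 1 \<or> z k = - 1" for k
  proof -
    have "cnj (?E k) = of_real \<alpha> + \<i> * z k * of_real \<beta> * z k"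
      using that(2) by (subst cnj_exp[symmetric], use that(2) in force, subst split)
        (use that(1)[unfolded revival_def, THEN bspec, of "z k"] in auto)
    also have "\<dots> = cnj ?w"
      using that(2) by auto
    finally show ?thesis
      by (simp only: complex_cnj_cancel_iff)
  qed
  \<comment> \<open>Comparing \<open>k\<close> with \<open>- k\<close> (where \<open>r\<close> changes sign and \<open>c\<close>, \<open>z\<close> do not) shows that \<open>exp (t r\<^sub>k)\<close> is real.\<close>
  have revival: "revival k" if k: "?E k = ?w" "?E (- k) = ?w" "z k = 1 \<or> z k = - 1" for k
  proof -
    define e where "e = exp (- (of_real t * r k))"
    have E: "cnj ?w = exp (- (of_real t * r j)) * exp (- (\<i> * z j * of_real (t * c j)))"
      if "?E j = ?w" "z j = 1 \<or> z j = - 1" for j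
      using that cnj_exp[of "z j" j] split[of j "z j"] by auto
    have zm: "z (- k) = z k"
      using k(3) by (auto simp: z_minus)
    have cnj_e: "exp (- (of_real t * r (- k))) = cnj e"
      by (simp add: e_def exp_cnj r_minus cnj_r)
    have e: "cnj ?w = e * exp (- (\<i> * z k * of_real (t * c k)))"
      unfolding e_def by (rule E) fact+
    have "cnj ?w = cnj e * exp (- (\<i> * z k * of_real (t * c k)))"
      using E[of "- k"] k unfolding cnj_e zm c_minus by blast
    with e have "cnj e = e"
      by simp
    from revival_equation_of_real_phase[OF k(3) this, of "t * c k" \<alpha> \<beta>] e show ?thesis
      unfolding revival_def e_def by simp
  qed
  have plus_iff: "(\<exists>j::int. (eig_plus X R L S k - eig_plus X R L S 0) * of_real t
      = 2 * of_real pi * \<i> * of_int j) \<longleftrightarrow> ?E k = ?E 0" if "z k = 1" for k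
    unfolding exp_eq_iff_diff_multiple that z0 plus by (simp add: algebra_simps)
  have minus_iff: "(\<exists>j::int. (eig_minus X R L S k - eig_plus X R L S 0) * of_real t
      = 2 * of_real pi * \<i> * of_int j) \<longleftrightarrow> ?E k = ?E 0" if "z k = - 1" for k
    unfolding exp_eq_iff_diff_multiple that z0 plus minus by (simp add: algebra_simps)
  have E0: "?E 0 = exp (of_real t * eig_plus X R L S 0)"
    by (simp add: z0 plus)
  have at_zero: "\<alpha> = Re (?E 0) \<and> \<beta> = - Im (?E 0) \<longleftrightarrow> ?E 0 = ?w"
    by (auto simp: complex_eq_iff)
  have "(\<forall>k1\<in>K1. \<exists>j::int. (eig_plus X R L S k1 - eig_plus X R L S 0) * of_real t
          = 2 * of_real pi * \<i> * of_int j) \<longleftrightarrow> (\<forall>k. z k = 1 \<longrightarrow> ?E k = ?E 0)"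
    using plus_iff by (simp add: Ball_def K1)
  moreover have "(\<forall>k2\<in>K2. \<exists>j::int. (eig_minus X R L S k2 - eig_plus X R L S 0) * of_real t
          = 2 * of_real pi * \<i> * of_int j) \<longleftrightarrow> (\<forall>k. z k = - 1 \<longrightarrow> ?E k = ?E 0)"
    using minus_iff by (simp add: Ball_def K2)
  moreover have "UNIV = K1 \<union> K2 \<longleftrightarrow> (\<forall>k. z k = 1 \<or> z k = - 1)"
    by (auto simp: K1 K2 set_eq_iff)
  moreover have "\<alpha>\<^sup>2 + \<beta>\<^sup>2 = 1 \<and> (\<forall>k. revival k) \<longleftrightarrow> (\<forall>k. z k = 1 \<or> z k = - 1) \<and>
      (\<forall>k. z k = 1 \<longrightarrow> ?E k = ?E 0) \<and> (\<forall>k. z k = - 1 \<longrightarrow> ?E k = ?E 0) \<and> ?E 0 = ?w"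
    (is "?lhs \<longleftrightarrow> ?rhs")
  proof
    assume ?lhs
    then have "z k = 1 \<or> z k = - 1" for k
      using revival_phase_real[OF \<open>\<alpha> \<noteq> 0\<close> \<open>\<beta> \<noteq> 0\<close> norm_z] unfolding revival_def by blast
    then show ?rhs
      using phase \<open>?lhs\<close> by metis
  next
    assume ?rhs
    then have "?E k = ?w" for k
      by metis
    then have "\<forall>k. revival k"
      using revival \<open>?rhs\<close> by blast
    \<comment> \<open>The normalization is not among the listed conditions; it follows because the
      reference eigenvalue is purely imaginary, so its exponential has modulus
      \<open>1\<close>.\<close>
    moreover have "\<alpha>\<^sup>2 + \<beta>\<^sup>2 = 1"
    proof -
      have "Re (r 0) = 0"
        by (simp add: r_def Re_char_diff)
      then have "cmod (?E 0) = 1"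
        by (simp add: z0)
      then have "(cmod ?w)\<^sup>2 = 1"
        using \<open>?rhs\<close> by simp
      then show ?thesis
        by (simp add: cmod_power2)
    qed
    ultimately show ?lhs
      by blast
  qed
  ultimately show ?thesis
    unfolding fr E0[symmetric] at_zero by blast
qed

end
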